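(* Let $\Pi=\{2431,2413,3142,4132,1432,1342,1324,1423\}$. Then $$\sum_{n\ge 0}|\operatorname{Av}_n(\Pi)|\,x^n = C(1+x^3C),$$ where $C=C(x)$ is the generating function of the Catalan numbers.
   Context: $\operatorname{Av}_n(\Pi)$ is the set of permutations of $[n]$ that avoid (in the classical sense) every pattern in $\Pi$: a permutation $\pi$ contains $p\in S_k$ if some subsequence of $\pi$ of length $k$ is in the same relative order as $p$, and avoids $p$ otherwise. Generating functions are ordinary; $C(x)=\sum_{n\ge0}\frac{1}{n+1}\binom{2n}{n}x^n$. *)

theory Defs
  imports
    "HOL-Library.Sublist"
    "HOL-Combinatorics.Multiset_Permutations"
    "HOL-Computational_Algebra.Formal_Power_Series"
begin

text \<open>Permutations of \<open>[n]\<close> are written in one-line notation, as the elements of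
  \<^term>\<open>permutations_of_set {1..n}\<close>.\<close>

definition same_order :: "nat list \<Rightarrow> nat list \<Rightarrow> bool" where
  "same_order xs ys \<longleftrightarrow> length xs = length ys \<and>
     (\<forall>i<length xs. \<forall>j<length xs. xs ! i < xs ! j \<longleftrightarrow> ys ! i < ys ! j)"

text \<open>\<^term>\<open>subseq ys xs\<close> refers to subsequences that need not be contiguous.\<close>

definition contains_pattern :: "nat list \<Rightarrow> nat list \<Rightarrow> bool" where
  "contains_pattern \<pi> p \<longleftrightarrow> (\<exists>ys. subseq ys \<pi> \<and> same_order ys p)"

definition Av :: "nat \<Rightarrow> nat list set \<Rightarrow> nat list set" where
  "Av n P = {\<pi> \<in> permutations_of_set {1..n}. \<forall>p\<in>P. \<not> contains_pattern \<pi> p}"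

definition catalan_gf :: "rat fps" where
  "catalan_gf = Abs_fps (\<lambda>n. 1 / of_nat (n + 1) * of_nat ((2 * n) choose n))"

end

theory Submission
  imports Defs
begin

text \<open>The ten patterns of length 4 that contain 132 are the eight forbidden ones, 1243 and 2143.
  Hence, in a permutation of \<open>[n]\<close> in the class, every further entry must stand to the left of and
  below the descent of any occurrence of 132. So the permutation either avoids 132 or is
  \<open>\<sigma> n (n - 1)\<close> with \<open>\<sigma>\<close> nonempty and avoiding 132, which gives \<open>C\<^sub>n + C\<^sub>n\<^sub>-\<^sub>2\<close> permutations
  for \<open>n \<ge> 3\<close>.\<close>

section \<open>The Catalan generating function\<close>

unbundle fps_syntax

text \<open>Follows from writing the central binomial coefficients with factorials. As a recurrence
  of first order it amounts to the differential equation behind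
  \<open>catalan_gf_quadratic\<close>.\<close>

lemma catalan_gf_Suc:
  "of_nat (n + 2) * catalan_gf $ Suc n = of_nat (4 * n + 2) * catalan_gf $ n"
proof -
  have 1: "(of_nat ((2 * m) choose m) :: rat) = fact (2 * m) / (fact m * fact m)" for m
    using binomial_fact[of m "2 * m"] by simp
  have "(fact (2 * Suc n) :: rat) = of_nat (2 * n + 2) * of_nat (2 * n + 1) * fact (2 * n)"
    by (simp add: algebra_simps)
  then show ?thesis
    unfolding catalan_gf_def fps_nth_Abs_fps 1 by (simp add: divide_simps) (simp add: algebra_simps)
qed

text \<open>The differential equation \<open>(1 - 4x) F' = -2F\<close> for \<open>F = 1 - 2xC\<close> forces \<open>F\<^sup>2 = 1 - 4x\<close>.\<close>

lemma catalan_gf_quadratic: "catalan_gf = 1 + fps_X * catalan_gf\<^sup>2"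
proof -
  define F :: "rat fps" where "F = 1 - 2 * fps_X * catalan_gf"
  have F: "F $ 0 = 1" "F $ Suc n = - 2 * catalan_gf $ n" for n
    by (simp_all add: F_def mult.assoc numeral_fps_const)
  have dF: "(1 - 4 * fps_X) * fps_deriv F = - 2 * F"
  proof (rule fps_ext)
    fix n
    show "((1 - 4 * fps_X) * fps_deriv F) $ n = (- 2 * F) $ n"
    proof (cases n)
      case 0
      have "catalan_gf $ 0 = 1" by (simp add: catalan_gf_def)
      then show ?thesis using 0 
        by (simp add: F algebra_simps numeral_fps_const F(2)[of 0, simplified])
    next
      case (Suc m)
      have "of_nat (m + 2) * F $ (m + 2) = of_nat (4 * m + 2) * F $ (m + 1)"
        using catalan_gf_Suc[of m] F(2)[of m] F(2)[of "Suc m"] by (simp add: algebra_simps)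
      then show ?thesis using Suc
        by (simp add: left_diff_distrib mult.assoc numeral_fps_const algebra_simps)
    qed
  qed
  define G where "G = F\<^sup>2"
  have dG: "(1 - 4 * fps_X) * fps_deriv G = - 4 * G"
  proof -
    have "(1 - 4 * fps_X) * fps_deriv G = 2 * F * ((1 - 4 * fps_X) * fps_deriv F)"
      by (simp add: G_def power2_eq_square algebra_simps)
    then show ?thesis unfolding dF by (simp add: G_def power2_eq_square)
  qed
  have G0: "G $ 0 = 1" by (simp add: G_def power2_eq_square F)
  have G1: "of_nat (Suc n) * G $ Suc n = (4 * of_nat n - 4) * G $ n" for n
  proof -
    have "((1 - 4 * fps_X) * fps_deriv G) $ n = (- 4 * G) $ n" by (simp only: dG)
    then show ?thesis
      by (cases n) (simp_all add: left_diff_distrib mult.assoc numeral_fps_const algebra_simps)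
  qed
  \<comment> \<open>The factor \<open>4 * of_nat n - 4\<close> in \<open>G1\<close> vanishes at
    \<open>n = 1\<close>. This kills the coefficient of degree 2, and the recurrence then kills all
    later ones.\<close>
  have G2: "G $ Suc (Suc n) = 0" for n
  proof (induction n)
    case 0 show ?case using G1[of 1] by simp
  next
    case (Suc n) then show ?case using G1[of "Suc (Suc n)"] by simp
  qed
  have "G = 1 - 4 * fps_X"
  proof (rule fps_ext)
    fix n show "G $ n = (1 - 4 * fps_X) $ n"
    proof (cases n)
      case (Suc m)
      then show ?thesis using G1[of 0] G0 G2 by (cases m) (simp_all add: numeral_fps_const)
    qed (simp add: G0)
  qed
  \<comment> \<open>Expanding \<open>F\<^sup>2\<close> and moving \<open>1 - 4 * fps_X\<close> to
    the left leaves a multiple of \<open>4 * fps_X\<close>, a nonzero factor that cancels because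
    power series over a field have no zero divisors.\<close>
  then have "4 * fps_X * (1 + fps_X * catalan_gf\<^sup>2 - catalan_gf) = 0"
    by (simp add: G_def F_def power2_eq_square algebra_simps)
  then show ?thesis by simp
qed

text \<open>The quadratic equation read coefficientwise; this convolution is what cutting a
  permutation at its maximum produces.\<close>

lemma catalan_gf_nth_Suc:
  "catalan_gf $ Suc n = (\<Sum>i\<le>n. catalan_gf $ i * catalan_gf $ (n - i))"
proof -
  have "catalan_gf $ Suc n = (catalan_gf * catalan_gf) $ n"
    by (subst catalan_gf_quadratic) (simp add: power2_eq_square)
  then show ?thesis by (simp add: fps_mult_nth atMost_atLeast0)
qed

section \<open>Permutations avoiding 132\<close>

text \<open>Peeling off the heads replaces the quantifiers over indices by comparisons of entries,
  which simplify on explicit lists.\<close>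

lemma same_order_Cons_Cons:
  "same_order (y # ys) (q # qs) \<longleftrightarrow> same_order ys qs \<and>
     list_all2 (\<lambda>u v. (y < u \<longleftrightarrow> q < v) \<and> (u < y \<longleftrightarrow> v < q)) ys qs"
proof -
  have "(\<forall>i<Suc n. \<forall>j<Suc n. P i j) \<longleftrightarrow>
      P 0 0 \<and> (\<forall>i<n. \<forall>j<n. P (Suc i) (Suc j)) \<and> (\<forall>i<n. P 0 (Suc i) \<and> P (Suc i) 0)"
    for P :: "nat \<Rightarrow> nat \<Rightarrow> bool" and n
    by (auto simp: All_less_Suc2)
  note * = this[where n = "length ys"]
  show ?thesis
    unfolding same_order_def list_all2_conv_all_nth list.size add_Suc_right add_0_right *
      nth_Cons_0 nth_Cons_Suc
    by (cases "length ys = length qs") simp_all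
qed

text \<open>Rewriting is driven by the pattern alone: an explicit pattern fixes the length of
  \<open>xs\<close> and leaves inequalities between its entries.\<close>

lemma same_order_iffs:
  "same_order xs [] \<longleftrightarrow> xs = []"
  "same_order xs (q # qs) \<longleftrightarrow>
     (\<exists>y ys. xs = y # ys \<and> same_order ys qs \<and>
        list_all2 (\<lambda>u v. (y < u \<longleftrightarrow> q < v) \<and> (u < y \<longleftrightarrow> v < q)) ys qs)"
proof -
  show "same_order xs [] \<longleftrightarrow> xs = []" by (auto simp: same_order_def)
  show "same_order xs (q # qs) \<longleftrightarrow>
     (\<exists>y ys. xs = y # ys \<and> same_order ys qs \<and>
        list_all2 (\<lambda>u v. (y < u \<longleftrightarrow> q < v) \<and> (u < y \<longleftrightarrow> v < q)) ys qs)"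
  proof (cases xs)
    case Nil
    then show ?thesis by (simp add: same_order_def)
  qed (simp add: same_order_Cons_Cons)
qed

lemma contains_132_iff:
  "contains_pattern \<pi> [1,3,2] \<longleftrightarrow> (\<exists>a b c. subseq [a,c,b] \<pi> \<and> a < b \<and> b < c)"
proof -
  have *: "same_order ys [1,3,2] \<longleftrightarrow> (\<exists>a c b. ys = [a,c,b] \<and> a < b \<and> b < c)" for ys
    by (simp add: same_order_iffs list_all2_Cons2) auto
  show ?thesis unfolding contains_pattern_def * by blast
qed

section \<open>Decomposition at the maximum and the count of 132-avoiders\<close>

lemma set_mono_subseq: "subseq xs ys \<Longrightarrow> set xs \<subseteq> set ys"
  by (auto elim: list_emb_set)

text \<open>An entry \<open>x\<close> of \<open>l\<close> below an entry \<open>y\<close> of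
  \<open>r\<close> forms 132 together with \<open>m\<close>. Conversely, an occurrence that stays
  inside neither \<open>l\<close> nor \<open>r\<close> has its smallest entry in \<open>l\<close>
  and its middle one in \<open>r\<close>, so it breaks the order condition between the two
  sides.\<close>

lemma avoids_132_split_max:
  assumes "distinct (l @ m # r)" and "\<forall>x\<in>set l \<union> set r. x < m"
  shows "\<not> contains_pattern (l @ m # r) [1,3,2] \<longleftrightarrow>
    \<not> contains_pattern l [1,3,2] \<and> \<not> contains_pattern r [1,3,2] \<and>
    (\<forall>x\<in>set l. \<forall>y\<in>set r. y < x)"
proof -
  have "contains_pattern (l @ m # r) [1,3,2]" if "contains_pattern l [1,3,2]"
    using that unfolding contains_132_iff by (meson list_emb_append2 list_emb_prefix)
  moreover have "contains_pattern (l @ m # r) [1,3,2]" if "contains_pattern r [1,3,2]"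
    using that unfolding contains_132_iff by (meson list_emb_append2 list_emb_Cons)
  moreover have "contains_pattern (l @ m # r) [1,3,2]"
    if "x \<in> set l" "y \<in> set r" "\<not> y < x" for x y
  proof -
    have "subseq ([x] @ [m,y]) (l @ m # r)"
      using that by (intro list_emb_append_mono) (auto simp: subseq_singleton_left)
    moreover have "x < y" "y < m" using that assms by (auto simp: not_less le_less)
    ultimately show ?thesis unfolding contains_132_iff by auto
  qed
  moreover have "contains_pattern l [1,3,2] \<or> contains_pattern r [1,3,2]"
    if "contains_pattern (l @ m # r) [1,3,2]" and lr: "\<forall>x\<in>set l. \<forall>y\<in>set r. y < x"
  proof -
    from that obtain a b c where s: "subseq [a,c,b] (l @ m # r)" and o: "a < b" "b < c"
      unfolding contains_132_iff by auto
    from s obtain u v where uv: "[a,c,b] = u @ v" "subseq u l" "subseq v (m # r)"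
      unfolding subseq_append_iff by auto
    \<comment> \<open>The smallest entry cannot be \<open>m\<close>, so an occurrence inside
      \<open>m # r\<close> already lies in \<open>r\<close>.\<close>
    have "c \<le> m" using set_mono_subseq[OF s] assms(2) by (auto simp: less_imp_le)
    then have "a \<noteq> m" using o by simp
    have "u = [] \<and> v = [a,c,b] \<or> u = [a] \<and> v = [c,b] \<or> u = [a,c] \<and> v = [b] \<or> u = [a,c,b] \<and> v = []"
      using uv(1) by (simp add: Cons_eq_append_conv) metis
    then consider "u = []" "v = [a,c,b]" | "u = [a]" "v = [c,b]" | "u = [a,c]" "v = [b]"
      | "u = [a,c,b]" "v = []"
      by metis
    then show ?thesis
    proof cases
      case 1
      then have "subseq [a,c,b] r" using uv(3) \<open>a \<noteq> m\<close> by (simp add: subseq_Cons2_iff)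
      then show ?thesis using o contains_132_iff by blast
    next
      case 2
      then have "a \<in> set l" using set_mono_subseq[OF uv(2)] by auto
      moreover have "b \<in> set r"
        using uv(3) 2 set_mono_subseq[of "[c,b]" r]
        by (auto simp: subseq_Cons2_iff subseq_singleton_left split: if_splits)
      ultimately show ?thesis using lr o by fastforce
    next
      case 3
      then have "a \<in> set l" "c \<in> set l" using set_mono_subseq[OF uv(2)] by auto
      moreover have "b = m \<or> b \<in> set r" using uv(3) 3
        by (auto simp: subseq_singleton_left split: if_splits)
      ultimately show ?thesis using lr o assms(2) by (metis UnI1 less_asym)
    next
      case 4
      then show ?thesis using uv(2) o contains_132_iff by blast
    qed
  qed
  ultimately show ?thesis by blast
qed

text \<open>General value sets are needed because the two sides of the maximum are permutations of
  sets other than \<open>{1..n}\<close>.\<close>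

definition avoiders_132 :: "nat set \<Rightarrow> nat list set" where
  "avoiders_132 S = {\<pi> \<in> permutations_of_set S. \<not> contains_pattern \<pi> [1,3,2]}"

lemma finite_avoiders_132 [simp]: "finite S \<Longrightarrow> finite (avoiders_132 S)"
  by (simp add: avoiders_132_def)

text \<open>Every entry left of the maximum exceeds every entry right of it. Hence the length
  \<open>i\<close> of the right side determines its values: they are the \<open>i\<close> smallest,
  and the left side receives the others.\<close>

lemma avoiders_132_eq_UN:
  assumes xs: "sorted xs" "distinct xs" and m: "\<forall>x\<in>set xs. x < m"
  shows "avoiders_132 (insert m (set xs)) =
    (\<Union>i\<le>length xs. (\<lambda>(l, r). l @ m # r) `
       (avoiders_132 (set (drop i xs)) \<times> avoiders_132 (set (take i xs))))"
proof (intro equalityI subsetI)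
  fix \<pi> assume "\<pi> \<in> avoiders_132 (insert m (set xs))"
  then have p: "set \<pi> = insert m (set xs)" "distinct \<pi>" "\<not> contains_pattern \<pi> [1,3,2]"
    by (auto simp: avoiders_132_def permutations_of_set_def)
  from p(1) obtain l r where lr: "\<pi> = l @ m # r" by (metis insertI1 split_list)
  have "m \<notin> set xs" using m by blast
  with p lr have s: "set l \<union> set r = set xs" by auto
  then have "\<forall>x\<in>set l \<union> set r. x < m" using m by simp
  with p lr avoids_132_split_max have
    av: "\<not> contains_pattern l [1,3,2]" "\<not> contains_pattern r [1,3,2]"
      "\<forall>x\<in>set l. \<forall>y\<in>set r. y < x" by auto
  define i where "i = length r"
  \<comment> \<open>Both lists are increasing with the same entries; the right one is sorted across
    the seam because \<open>r\<close> lies below \<open>l\<close>.\<close>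
  have "xs = sort r @ sort l"
  proof (rule sorted_distinct_set_unique)
    show "sorted (sort r @ sort l)" using av(3) by (auto simp: sorted_append less_imp_le)
    show "distinct (sort r @ sort l)" using p(2) lr by auto
  qed (use xs s in auto)
  then have "set (take i xs) = set r" "set (drop i xs) = set l" "i \<le> length xs"
    by (auto simp: i_def)
  then show "\<pi> \<in> (\<Union>i\<le>length xs. (\<lambda>(l, r). l @ m # r) `
       (avoiders_132 (set (drop i xs)) \<times> avoiders_132 (set (take i xs))))"
    using lr av p by (intro UN_I[of i]) (auto simp: avoiders_132_def permutations_of_set_def)
next
  fix \<pi> assume "\<pi> \<in> (\<Union>i\<le>length xs. (\<lambda>(l, r). l @ m # r) `
       (avoiders_132 (set (drop i xs)) \<times> avoiders_132 (set (take i xs))))"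
  then obtain i l r where \<pi>: "\<pi> = l @ m # r" and
    l: "set l = set (drop i xs)" "distinct l" "\<not> contains_pattern l [1,3,2]" and
    r: "set r = set (take i xs)" "distinct r" "\<not> contains_pattern r [1,3,2]"
    by (auto simp: avoiders_132_def permutations_of_set_def)
  have un: "set l \<union> set r = set xs"
    unfolding l r by (metis append_take_drop_id set_append sup_commute)
  have "sorted (take i xs @ drop i xs)" "distinct (take i xs @ drop i xs)" using xs by simp_all
  then have less: "\<forall>x\<in>set l. \<forall>y\<in>set r. y < x"
    unfolding l r sorted_append distinct_append by (metis disjoint_iff le_less)
  have "distinct \<pi>" using \<pi> l(2) r(2) less m un by fastforce
  moreover have "\<forall>x\<in>set l \<union> set r. x < m" using m un by simp
  ultimately have "\<not> contains_pattern \<pi> [1,3,2]"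
    using l r less \<pi> avoids_132_split_max by metis
  then show "\<pi> \<in> avoiders_132 (insert m (set xs))"
    using \<open>distinct \<pi>\<close> un \<pi> by (auto simp: avoiders_132_def permutations_of_set_def)
qed

text \<open>Strong induction on the size: removing the maximum yields the Catalan convolution,
  summed over the length of the right side.\<close>

lemma card_avoiders_132:
  "finite S \<Longrightarrow> of_nat (card (avoiders_132 S)) = catalan_gf $ card S"
proof (induction "card S" arbitrary: S rule: less_induct)
  case less
  show ?case
  proof (cases "S = {}")
    case True
    have "subseq [a, c, b] [] \<longleftrightarrow> False" for a b c :: nat by simp
    then have "avoiders_132 {} = {[]}" unfolding avoiders_132_def contains_132_iff by auto
    then show ?thesis by (simp add: True catalan_gf_def)
  next
    case False
    define m xs where "m = Max S" and "xs = sorted_list_of_set (S - {m})"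
    have xs: "sorted xs" "distinct xs" "set xs = S - {m}"
      using less.prems by (simp_all add: xs_def)
    have mS: "m \<in> S" using False less.prems by (simp add: m_def)
    have m: "\<forall>x\<in>set xs. x < m"
      unfolding xs using less.prems by (auto simp: m_def intro: le_neq_trans)
    have S: "S = insert m (set xs)" using mS xs by auto
    have cS: "card S = Suc (length xs)"
      using xs(2) m by (subst S) (auto simp: distinct_card)
    let ?A = "\<lambda>i. avoiders_132 (set (drop i xs)) \<times> avoiders_132 (set (take i xs))"
    let ?f = "\<lambda>(l, r). l @ m # r"
    \<comment> \<open>Neither side contains \<open>m\<close>, so its position determines both. Two
      indices are allowed so that the fact serves both for disjoint images and for injectivity on
      each product.\<close>
    have inj: "l = l' \<and> r = r'"
      if "(l, r) \<in> ?A i" "(l', r') \<in> ?A j" "l @ m # r = l' @ m # r'" for l r l' r' i j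
    proof -
      have "set l \<subseteq> set xs" "set r \<subseteq> set xs" "set l' \<subseteq> set xs" "set r' \<subseteq> set xs"
        using that by (auto simp: avoiders_132_def permutations_of_set_def
            dest: in_set_takeD in_set_dropD)
      then have "m \<notin> set l \<union> set r \<union> set l' \<union> set r'" using m by blast
      with that(3) show ?thesis by (auto simp: append_Cons_eq_iff)
    qed
    have len: "length r = i" if "(l, r) \<in> ?A i" "i \<le> length xs" for l r i
      using that xs(2) by (auto simp: avoiders_132_def permutations_of_set_def distinct_card[symmetric])
        (simp add: distinct_card)
    have "card (avoiders_132 S) = card (\<Union>i\<le>length xs. ?f ` ?A i)"
      unfolding S avoiders_132_eq_UN[OF xs(1,2) m] ..
    also have "\<dots> = (\<Sum>i\<le>length xs. card (?f ` ?A i))"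
    proof (intro card_UN_disjoint ballI impI)
      fix i j assume ij: "i \<in> {..length xs}" "j \<in> {..length xs}" "i \<noteq> j"
      show "?f ` ?A i \<inter> ?f ` ?A j = {}"
      proof (intro equals0I)
        fix \<pi> assume "\<pi> \<in> ?f ` ?A i \<inter> ?f ` ?A j"
        then obtain q q' where q: "q \<in> ?A i" "q' \<in> ?A j" "?f q = ?f q'" by fastforce
        obtain l r l' r' where lr: "q = (l, r)" "q' = (l', r')" by fastforce
        have "r = r'" using inj q unfolding lr prod.case by blast
        then show False using len[of l r i] len[of l' r' j] q(1,2) ij unfolding lr by simp
      qed
    qed auto
    also have "\<dots> = (\<Sum>i\<le>length xs. card (?A i))"
      by (intro sum.cong refl card_image) (use inj in \<open>auto simp: inj_on_def\<close>)
    finally have "of_nat (card (avoiders_132 S)) =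
        (\<Sum>i\<le>length xs. of_nat (card (avoiders_132 (set (drop i xs)))) *
           of_nat (card (avoiders_132 (set (take i xs)))) :: rat)"
      by (simp add: card_cartesian_product)
    also have "\<dots> = (\<Sum>i\<le>length xs. catalan_gf $ (length xs - i) * catalan_gf $ i)"
      using xs(2) cS by (intro sum.cong refl arg_cong2[where f = "(*)"])
        (subst less.hyps; simp add: distinct_card)+
    also have "\<dots> = catalan_gf $ card S"
      unfolding cS catalan_gf_nth_Suc by (simp add: mult.commute)
    finally show ?thesis .
  qed
qed

section \<open>The class\<close>

text \<open>As an abbreviation it coincides with the explicit set in the theorem without
  unfolding.\<close>

abbreviation patterns :: "nat list set" where
  "patterns \<equiv> {[2,4,3,1], [2,4,1,3], [3,1,4,2], [4,1,3,2],
                [1,4,3,2], [1,3,4,2], [1,3,2,4], [1,4,2,3]}"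

lemma contains_pattern_mono:
  "subseq xs ys \<Longrightarrow> contains_pattern xs p \<Longrightarrow> contains_pattern ys p"
  unfolding contains_pattern_def by (blast intro: subseq_order.order_trans)

lemma subseq_delete1:
  "subseq [y,z,w] [x,y,z,w]" "subseq [x,z,w] [x,y,z,w]"
  "subseq [x,y,w] [x,y,z,w]" "subseq [x,y,z] [x,y,z,w]"
  using prefix_imp_subseq[of "[x,y,z]" "[x,y,z,w]"] by (auto simp: subseq_singleton_left)

lemma same_order_patterns_imp_132:
  assumes "p \<in> patterns" and "same_order [x,y,z,w] p"
  shows "contains_pattern [x,y,z,w] [1,3,2]"
proof -
  \<comment> \<open>The disjuncts are occurrences of 132 left after omitting the fourth, third,
    second or first entry, respectively.\<close>
  have "x < z \<and> z < y \<or> x < w \<and> w < y \<or> x < w \<and> w < z \<or> y < w \<and> w < z"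
    using assms by (elim insertE emptyE; simp add: same_order_iffs)
  then show ?thesis unfolding contains_132_iff using subseq_delete1 by blast
qed

lemma contains_patternsE:
  assumes "contains_pattern \<pi> p" and "p \<in> patterns"
  obtains x y z w where "subseq [x,y,z,w] \<pi>" and "same_order [x,y,z,w] p"
proof -
  obtain ys where ys: "subseq ys \<pi>" "same_order ys p"
    using assms(1) by (auto simp: contains_pattern_def)
  have "length ys = 4" using ys(2) assms(2) unfolding same_order_def by auto
  then obtain x y z w where "ys = [x,y,z,w]"
    by (auto simp: numeral_eq_Suc length_Suc_conv)
  then show thesis using ys that by blast
qed

text \<open>Used in contrapositive form: all 132-avoiders belong to the class.\<close>

lemma contains_patterns_imp_132:
  assumes "contains_pattern \<pi> p" and "p \<in> patterns"
  shows "contains_pattern \<pi> [1,3,2]"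
  using assms same_order_patterns_imp_132 contains_pattern_mono
  by (elim contains_patternsE) blast+

section \<open>Structure of the members of the class that contain 132\<close>

lemma distinct_subseq: "distinct ys \<Longrightarrow> subseq xs ys \<Longrightarrow> distinct xs"
  by (auto simp: subseq_conv_nths)

text \<open>A fourth entry to the right of \<open>c\<close> completes a forbidden pattern whatever
  its size; to the left of \<open>c\<close> it does so if it exceeds \<open>b\<close>. So nothing
  follows or separates \<open>c\<close> and \<open>b\<close>, and everything before them is smaller
  than \<open>b\<close>.\<close>

lemma occurrence_132_at_end:
  assumes avoid: "\<forall>p\<in>patterns. \<not> contains_pattern \<pi> p" and "distinct \<pi>"
    and acb: "subseq [a,c,b] \<pi>" "a < b" "b < c"
  obtains \<sigma> where "\<pi> = \<sigma> @ [c,b]" and "\<forall>x\<in>set \<sigma>. x < b"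
proof -
  have no: "\<not> same_order ys p" if "subseq ys \<pi>" "p \<in> patterns" for ys p
    using avoid that unfolding contains_pattern_def by blast
  have dist: "distinct ys" if "subseq ys \<pi>" for ys
    using that distinct_subseq \<open>distinct \<pi>\<close> by blast
  \<comment> \<open>In this and the next three claims, the gaps between \<open>a\<close>,
    \<open>b\<close>, \<open>c\<close> that may hold \<open>d\<close> are matched, in order, with
    the forbidden patterns cited.\<close>
  have last: "\<not> subseq [a,c,b,d] \<pi>" for d
  proof
    assume s: "subseq [a,c,b,d] \<pi>"
    from dist[OF s] consider "d < a" | "a < d" "d < b" | "b < d" "d < c" | "c < d"
      by fastforce
    then show False
      using no[OF s, of "[2,4,3,1]"] no[OF s, of "[1,4,3,2]"]
        no[OF s, of "[1,4,2,3]"] no[OF s, of "[1,3,2,4]"] acb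
      by cases (simp_all add: same_order_iffs)
  qed
  have adjacent: "\<not> subseq [a,c,d,b] \<pi>" for d
  proof
    assume s: "subseq [a,c,d,b] \<pi>"
    from dist[OF s] consider "d < a" | "a < d" "d < b" | "b < d" "d < c" | "c < d"
      by fastforce
    then show False
      using no[OF s, of "[2,4,1,3]"] no[OF s, of "[1,4,2,3]"]
        no[OF s, of "[1,4,3,2]"] no[OF s, of "[1,3,4,2]"] acb
      by cases (simp_all add: same_order_iffs)
  qed
  \<comment> \<open>Only the gaps above \<open>b\<close> can be excluded here and in
    \<open>before\<close>: a smaller \<open>d\<close> gives 1243 or 2143, which are
    permitted.\<close>
  have between: "d < b" if s: "subseq [a,d,c,b] \<pi>" for d
  proof (rule ccontr)
    assume "\<not> d < b"
    with dist[OF s] consider "b < d" "d < c" | "c < d" by fastforce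
    then show False
      using no[OF s, of "[1,3,4,2]"] no[OF s, of "[1,4,3,2]"] acb
      by cases (simp_all add: same_order_iffs)
  qed
  have before: "d < b" if s: "subseq [d,a,c,b] \<pi>" for d
  proof (rule ccontr)
    assume "\<not> d < b"
    with dist[OF s] consider "b < d" "d < c" | "c < d" by fastforce
    then show False
      using no[OF s, of "[3,1,4,2]"] no[OF s, of "[4,1,3,2]"] acb
      by cases (simp_all add: same_order_iffs)
  qed
  from acb(1) obtain p0 p1 p2 p3 where \<pi>: "\<pi> = p0 @ [a] @ p1 @ [c] @ p2 @ [b] @ p3"
    by (auto dest!: list_emb_ConsD)
  \<comment> \<open>Taking a single entry from one block and nothing from the others presents that
    entry as the fourth one \<open>d\<close>.\<close>
  have sub: "subseq (y0 @ [a] @ y1 @ [c] @ y2 @ [b] @ y3) \<pi>"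
    if "subseq y0 p0" "subseq y1 p1" "subseq y2 p2" "subseq y3 p3" for y0 y1 y2 y3
    unfolding \<pi> using that by (intro list_emb_append_mono) auto
  have p3: "p3 = []"
    using sub[of "[]" "[]" "[]" "[hd p3]"] last by (cases p3) (simp_all add: subseq_singleton_left)
  have p2: "p2 = []"
    using sub[of "[]" "[]" "[hd p2]" "[]"] adjacent by (cases p2) (simp_all add: subseq_singleton_left)
  have "\<forall>d\<in>set p1. d < b"
    using sub[of "[]" "[_]" "[]" "[]"] between by (simp add: subseq_singleton_left)
  moreover have "\<forall>d\<in>set p0. d < b"
    using sub[of "[_]" "[]" "[]" "[]"] before by (simp add: subseq_singleton_left)
  ultimately have "\<forall>x\<in>set (p0 @ [a] @ p1). x < b" using acb(2) by auto
  then show thesis using that[of "p0 @ [a] @ p1"] \<pi> p2 p3 by simp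
qed

text \<open>An occurrence inside \<open>\<sigma>\<close> would bring a 132 with it. If it uses one
  entry of \<open>[c,b]\<close>, it ends in its maximum, so the pattern is 1324 and its first three
  entries form 132 in \<open>\<sigma>\<close>. If it uses both, the pattern ends in 43, which none
  of the eight does.\<close>

lemma append_descent_avoids_patterns:
  assumes \<sigma>: "\<not> contains_pattern \<sigma> [1,3,2]" and "\<forall>x\<in>set \<sigma>. x < b" and "b < c"
    and p: "p \<in> patterns"
  shows "\<not> contains_pattern (\<sigma> @ [c,b]) p"
proof
  assume "contains_pattern (\<sigma> @ [c,b]) p"
  then obtain x y z w where s: "subseq [x,y,z,w] (\<sigma> @ [c,b])" and o: "same_order [x,y,z,w] p"
    using p by (rule contains_patternsE)
  then obtain u v where uv: "[x,y,z,w] = u @ v" "subseq u \<sigma>" "subseq v [c,b]"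
    unfolding subseq_append_iff by blast
  have u: "\<forall>x\<in>set u. x < b" using set_mono_subseq[OF uv(2)] assms(2) by blast
  have no: "\<not> contains_pattern u [1,3,2]" using uv(2) \<sigma> contains_pattern_mono by blast
  have "length v \<le> 2" using list_emb_length[OF uv(3)] by simp
  then have "v = [] \<and> u = [x,y,z,w] \<or> v = [w] \<and> u = [x,y,z] \<or> v = [z,w] \<and> u = [x,y]"
    using uv(1) by (auto simp: Cons_eq_append_conv)
  then consider "u = [x,y,z,w]" | "v = [w]" "u = [x,y,z]" | "v = [z,w]" "u = [x,y]"
    by metis
  then show False
  proof cases
    case 1
    then show False using no same_order_patterns_imp_132[OF p o] by simp
  next
    case 2
    have "w = c \<or> w = b" using uv(3) 2 by (simp split: if_splits)
    then have "x < w" "y < w" "z < w" using 2 u \<open>b < c\<close> by auto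
    then have "p = [1,3,2,4]" using p o by (elim insertE emptyE; simp add: same_order_iffs)
    then have "x < z" "z < y" using o by (simp_all add: same_order_iffs)
    then have "contains_pattern [x,y,z] [1,3,2]"
      unfolding contains_132_iff by (intro exI[of _ x] exI[of _ z] exI[of _ y]) simp
    then show False using no 2(2) by simp
  next
    case 3
    then have "v = [c,b]" by (intro subseq_same_length[OF uv(3)]) simp
    then have "z = c" "w = b" using 3(1) by simp_all
    then have "x < w" "y < w" "w < z" using 3(2) u \<open>b < c\<close> by simp_all
    then show False using p o by (elim insertE emptyE; simp add: same_order_iffs)
  qed
qed

text \<open>Such short lists have no room for 132. The case is separate because
  \<open>[n, n - 1]\<close> is no permutation of \<open>{1..n}\<close> for \<open>n < 2\<close> and
  is itself a 132-avoider for \<open>n = 2\<close>.\<close>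

lemma Av_patterns_less_3:
  assumes "n < 3"
  shows "Av n patterns = avoiders_132 {1..n}"
proof -
  have "\<not> contains_pattern \<pi> [1,3,2]" if "\<pi> \<in> permutations_of_set {1..n}" for \<pi>
  proof -
    have "length \<pi> < 3" using that assms by (simp add: permutations_of_set_def distinct_card[symmetric])
    then show ?thesis unfolding contains_132_iff using list_emb_length by fastforce
  qed
  then show ?thesis
    using contains_patterns_imp_132 unfolding Av_def avoiders_132_def by blast
qed

lemma Av_patterns_ge_3:
  assumes "n \<ge> 3"
  shows "Av n patterns =
    avoiders_132 {1..n} \<union> (\<lambda>\<sigma>. \<sigma> @ [n, n - 1]) ` avoiders_132 {1..n - 2}"
proof (intro equalityI subsetI)
  fix \<pi> assume "\<pi> \<in> Av n patterns"
  then have \<pi>: "set \<pi> = {1..n}" "distinct \<pi>" and avoid: "\<forall>p\<in>patterns. \<not> contains_pattern \<pi> p"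
    unfolding Av_def permutations_of_set_def by blast+
  show "\<pi> \<in> avoiders_132 {1..n} \<union> (\<lambda>\<sigma>. \<sigma> @ [n, n - 1]) ` avoiders_132 {1..n - 2}"
  proof (cases "contains_pattern \<pi> [1,3,2]")
    case False
    then show ?thesis using \<pi> by (simp add: avoiders_132_def permutations_of_set_def)
  next
    case True
    then obtain a b c where "subseq [a,c,b] \<pi>" "a < b" "b < c"
      unfolding contains_132_iff by blast
    then obtain \<sigma> where \<sigma>: "\<pi> = \<sigma> @ [c,b]" "\<forall>x\<in>set \<sigma>. x < b"
      using avoid \<pi>(2) by (elim occurrence_132_at_end)
    have set: "insert c (insert b (set \<sigma>)) = {1..n}" using \<pi>(1) \<sigma>(1) by auto
    have "c \<in> {1..n}" "b \<in> {1..n}" unfolding set[symmetric] by simp_all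
    moreover have "n \<in> insert c (insert b (set \<sigma>))" "n - 1 \<in> insert c (insert b (set \<sigma>))"
      unfolding set using assms by auto
    \<comment> \<open>All other entries lie below \<open>b\<close>, so \<open>c\<close> and
      \<open>b\<close> are the two largest values.\<close>
    ultimately have cb: "c = n" "b = n - 1" using \<sigma>(2) \<open>b < c\<close> by auto
    have "set \<sigma> = {1..n} - {c, b}" unfolding set[symmetric] using \<pi>(2) \<sigma>(1) by auto
    also have "\<dots> = {1..n - 2}" unfolding cb by auto
    finally have "set \<sigma> = {1..n - 2}" .
    \<comment> \<open>An occurrence within \<open>\<sigma>\<close> would also have to end
      \<open>\<pi>\<close>, so its largest entry would be \<open>c\<close>, which would then appear
      twice.\<close>
    moreover have "\<not> contains_pattern \<sigma> [1,3,2]"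
    proof
      assume "contains_pattern \<sigma> [1,3,2]"
      then obtain a' b' c' where s: "subseq [a',c',b'] \<sigma>" "a' < b'" "b' < c'"
        unfolding contains_132_iff by blast
      then have "subseq [a',c',b'] \<pi>" unfolding \<sigma>(1) by (simp add: subseq_rev_drop_many)
      then obtain \<tau> where "\<pi> = \<tau> @ [c',b']"
        using avoid \<pi>(2) s by (elim occurrence_132_at_end)
      then have "c' = c" using \<sigma>(1) by simp
      then show False using set_mono_subseq[OF s(1)] \<pi>(2) \<sigma>(1) by auto
    qed
    ultimately show ?thesis
      using \<sigma>(1) cb \<pi>(2) by (auto simp: avoiders_132_def permutations_of_set_def)
  qed
next
  fix \<pi> assume "\<pi> \<in> avoiders_132 {1..n} \<union> (\<lambda>\<sigma>. \<sigma> @ [n, n - 1]) ` avoiders_132 {1..n - 2}"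
  then show "\<pi> \<in> Av n patterns"
  proof
    assume "\<pi> \<in> avoiders_132 {1..n}"
    then show ?thesis using contains_patterns_imp_132 unfolding Av_def avoiders_132_def by blast
  next
    assume "\<pi> \<in> (\<lambda>\<sigma>. \<sigma> @ [n, n - 1]) ` avoiders_132 {1..n - 2}"
    then obtain \<sigma> where \<sigma>: "\<pi> = \<sigma> @ [n, n - 1]" "set \<sigma> = {1..n - 2}" "distinct \<sigma>"
      "\<not> contains_pattern \<sigma> [1,3,2]"
      by (auto simp: avoiders_132_def permutations_of_set_def)
    have "\<not> contains_pattern \<pi> p" if "p \<in> patterns" for p
      unfolding \<sigma>(1) using \<sigma> assms that by (intro append_descent_avoids_patterns) auto
    moreover have "\<pi> \<in> permutations_of_set {1..n}"
      using \<sigma> assms by (auto simp: permutations_of_set_def)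
    ultimately show ?thesis unfolding Av_def by blast
  qed
qed

text \<open>The two families are disjoint: for \<open>n \<ge> 3\<close> the entry 1 belongs to
  \<open>\<sigma>\<close> and forms 132 with the final \<open>n\<close> and
  \<open>n - 1\<close>.\<close>

lemma card_Av_patterns_ge_3:
  assumes "n \<ge> 3"
  shows "card (Av n patterns) = card (avoiders_132 {1..n}) + card (avoiders_132 {1..n - 2})"
proof -
  have "\<sigma> @ [n, n - 1] \<notin> avoiders_132 {1..n}" if "\<sigma> \<in> avoiders_132 {1..n - 2}" for \<sigma>
  proof -
    have "1 \<in> set \<sigma>" using that assms by (auto simp: avoiders_132_def permutations_of_set_def)
    then have "subseq ([1] @ [n, n - 1]) (\<sigma> @ [n, n - 1])"
      by (intro list_emb_append_mono) (auto simp: subseq_singleton_left)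
    moreover have "1 < n - 1" "n - 1 < n" using assms by auto
    ultimately have "contains_pattern (\<sigma> @ [n, n - 1]) [1,3,2]"
      unfolding contains_132_iff by (metis append_Cons append_Nil)
    then show ?thesis by (simp add: avoiders_132_def)
  qed
  then have "avoiders_132 {1..n} \<inter> (\<lambda>\<sigma>. \<sigma> @ [n, n - 1]) ` avoiders_132 {1..n - 2} = {}"
    by blast
  then have "card (Av n patterns) = card (avoiders_132 {1..n}) +
      card ((\<lambda>\<sigma>. \<sigma> @ [n, n - 1]) ` avoiders_132 {1..n - 2})"
    unfolding Av_patterns_ge_3[OF assms] by (intro card_Un_disjoint) simp_all
  then show ?thesis by (simp add: card_image inj_on_def)
qed

theorem theorem6p2:
  shows "Abs_fps (\<lambda>n. of_nat (card (Av n
           {[2,4,3,1], [2,4,1,3], [3,1,4,2], [4,1,3,2],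
            [1,4,3,2], [1,3,4,2], [1,3,2,4], [1,4,2,3]})))
         = catalan_gf * (1 + fps_X ^ 3 * catalan_gf)"
proof (rule fps_ext)
  fix n
  \<comment> \<open>Grouping one factor \<open>fps_X\<close> with the square lets the quadratic
    equation turn it into \<open>catalan_gf - 1\<close>, so that the coefficients become sums of two
    Catalan numbers.\<close>
  have "catalan_gf * (1 + fps_X ^ 3 * catalan_gf) =
      catalan_gf + fps_X ^ 2 * (fps_X * catalan_gf\<^sup>2)"
    by (simp add: algebra_simps power2_eq_square power3_eq_cube)
  also have "fps_X * catalan_gf\<^sup>2 = catalan_gf - 1"
    using catalan_gf_quadratic by (simp add: algebra_simps)
  finally have rhs: "(catalan_gf * (1 + fps_X ^ 3 * catalan_gf)) $ n =
      catalan_gf $ n + (if n < 2 then 0 else (catalan_gf - 1) $ (n - 2))"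
    by (simp add: fps_X_power_mult_nth)
  have "of_nat (card (Av n patterns)) = (catalan_gf * (1 + fps_X ^ 3 * catalan_gf)) $ n"
  proof (cases "n < 3")
    case True
    have "catalan_gf $ 0 = 1" by (simp add: catalan_gf_def)
    \<comment> \<open>At \<open>n = 2\<close> the term is the constant coefficient of
      \<open>catalan_gf - 1\<close>, which is zero.\<close>
    then have "(if n < 2 then 0 else (catalan_gf - 1) $ (n - 2)) = 0" using True by simp
    then show ?thesis
      unfolding rhs Av_patterns_less_3[OF True] by (simp add: card_avoiders_132)
  next
    case False
    then show ?thesis
      unfolding rhs using card_Av_patterns_ge_3[of n] by (simp add: card_avoiders_132)
  qed
  then show "Abs_fps (\<lambda>n. of_nat (card (Av n patterns))) $ n =
      (catalan_gf * (1 + fps_X ^ 3 * catalan_gf)) $ n"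
    by simp
qed

end
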